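(* In the model of threads, the following four properties hold: (1) there exist two proof-like terms $\omega_0,\omega_1$ such that, for every $\pi\in\Pi$, $\omega_0k_\pi\Vdash\bot$ or $\omega_1k_\pi\Vdash\bot$; (2) there exist three proof-like terms $\alpha_0,\alpha_1,\alpha_2$ such that, for every $\xi\in\Lambda$ and $\pi\in\Pi$, $k_\pi\xi\alpha_0\Vdash\bot$ or $k_\pi\xi\alpha_1\Vdash\bot$ or $k_\pi\xi\alpha_2\Vdash\bot$; (3) there exists a proof-like term $\omega$ such that, for all $\xi,\xi'\in\Lambda$ with $\xi\neq\xi'$ and all $\pi\in\Pi$, $\omega k_\pi\xi\Vdash\bot$ or $\omega k_\pi\xi'\Vdash\bot$; (4) for each $\alpha\in\Lambda$, each $\pi\in\Pi$ and all pairwise distinct $\zeta_0,\zeta_1,\zeta_2\in\Lambda$, $k_\pi\alpha\zeta_0\Vdash\bot$ or $k_\pi\alpha\zeta_1\Vdash\bot$ or $k_\pi\alpha\zeta_2\Vdash\bot$.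
   Context: **Terms, stacks, execution.** Fix a countable set $\Pi_0$ of stack constants. The sets $\Lambda$ (terms) and $\Pi$ (stacks) are freely generated by: $B,C,E,I,K,W,\mathsf{cc},\varsigma$ are terms; each element of $\Pi_0$ is a stack; if $\xi,\eta\in\Lambda$, the application $\xi\eta$ is a term (application associates to the left); if $\xi\in\Lambda,\pi\in\Pi$, then $\xi\cdot\pi$ is a stack; if $\pi\in\Pi$, then $k_\pi$ is a term. A term is proof-like if it contains no $k_\pi$. A process is a pair $\xi\star\pi\in\Lambda\times\Pi$; $\xi$ is its head. Fix a recursive bijection $\xi\mapsto \mathsf n_\xi$ from $\Lambda$ onto $\mathbb N$; put $\sigma=(BW)(BB)$, $\underline 0=KI$, $\underline{n+1}=\sigma\,\underline n$. Let $\succ$ be the least reflexive transitive relation on processes such that, for all terms $\xi,\eta,\zeta$ and stacks $\pi,\varpi$: $\xi\eta\star\pi\succ\xi\star\eta\cdot\pi$; $I\star\xi\cdot\pi\succ\xi\star\pi$; $K\star\xi\cdot\eta\cdot\pi\succ\xi\star\pi$; $E\star\xi\cdot\eta\cdot\pi\succ\xi\eta\star\pi$; $W\star\xi\cdot\eta\cdot\pi\succ\xi\star\eta\cdot\eta\cdot\pi$; $C\star\xi\cdot\eta\cdot\zeta\cdot\pi\succ\xi\star\zeta\cdot\eta\cdot\pi$; $B\star\xi\cdot\eta\cdot\zeta\cdot\pi\succ\xi(\eta\zeta)\star\pi$; $\mathsf{cc}\star\xi\cdot\pi\succ\xi\star k_\pi\cdot\pi$; $k_\pi\star\xi\cdot\varpi\succ\xi\star\pi$;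 $\varsigma\star\xi\cdot\eta\cdot\pi\succ\xi\star\underline{\mathsf n_\eta}\cdot\pi$. **Model of threads.** Let $n\mapsto\pi_n$ ($n\in\mathbb N$) be an enumeration without repetition of the stack constants, and $n\mapsto\theta_n$ a recursive enumeration of the proof-like terms. The $n$-th thread is the set of processes $\xi\star\pi$ such that $\theta_n\star\pi_n\succ\xi\star\pi$. The set $\perp\!\!\!\perp$ is the complement, in $\Lambda\times\Pi$, of the union of all threads. For $\xi\in\Lambda$, $\xi\Vdash\bot$ means: $\xi\star\pi\in\perp\!\!\!\perp$ for every $\pi\in\Pi$ (i.e. $\xi$ never appears in head position in any thread). *)

theory Defs
  imports "HOL-Library.Nat_Bijection"
begin

section \<open>Recursive functions\<close>

text \<open>
  \<open>rec_fn n f\<close>: \<open>f\<close> is a total recursive function of \<open>n\<close> arguments, passed as a list of length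
  \<open>n\<close>; values on lists of any other length are irrelevant. Minimisation is applied to
  regular functions only, so that all functions are total.
\<close>

inductive rec_fn :: "nat \<Rightarrow> (nat list \<Rightarrow> nat) \<Rightarrow> bool" where
  zero: "rec_fn n (\<lambda>xs. 0)"
| succ: "rec_fn 1 (\<lambda>xs. Suc (hd xs))"
| proj: "i < n \<Longrightarrow> rec_fn n (\<lambda>xs. xs ! i)"
| comp: "rec_fn (length fs) g \<Longrightarrow> \<forall>f\<in>set fs. rec_fn n f
    \<Longrightarrow> rec_fn n (\<lambda>xs. g (map (\<lambda>f. f xs) fs))"
| prim: "rec_fn n f \<Longrightarrow> rec_fn (Suc (Suc n)) g
    \<Longrightarrow> rec_fn (Suc n) (\<lambda>xs. rec_nat (f (tl xs)) (\<lambda>k r. g (k # r # tl xs)) (hd xs))"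
| mini: "rec_fn (Suc n) f \<Longrightarrow> \<forall>xs. length xs = n \<longrightarrow> (\<exists>y. f (y # xs) = 0)
    \<Longrightarrow> rec_fn n (\<lambda>xs. LEAST y. f (y # xs) = 0)"

definition recursive :: "(nat \<Rightarrow> nat) \<Rightarrow> bool" where
  "recursive h \<longleftrightarrow> (\<exists>f. rec_fn 1 f \<and> (\<forall>n. h n = f [n]))"


section \<open>Terms and stacks\<close>

text \<open>
  The type \<open>'p\<close> is the set of stack constants. \<open>Quote\<close> is the instruction \<open>\<varsigma>\<close>, and \<open>Cont \<pi>\<close> is
  the continuation term \<open>k\<^sub>\<pi>\<close>.
\<close>

datatype 'p trm =
    cB | cC | cE | cI | cK | cW | cCC | Quote
  | App "'p trm" "'p trm"  (infixl "\<cdot>" 100)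
  | Cont "'p stack"
and 'p stack =
    Const 'p
  | Push "'p trm" "'p stack"  (infixr "\<bullet>" 90)

type_synonym 'p process = "'p trm \<times> 'p stack"

fun proof_like :: "'p trm \<Rightarrow> bool" where
  "proof_like (Cont \<pi>) = False"
| "proof_like (\<xi> \<cdot> \<eta>) = (proof_like \<xi> \<and> proof_like \<eta>)"
| "proof_like _ = True"

text \<open>
  The effective coding of the syntax which gives meaning to recursiveness of functions from and
  to terms, relative to a numbering \<open>e\<close> of the stack constants.
\<close>

primrec term_code :: "('p \<Rightarrow> nat) \<Rightarrow> 'p trm \<Rightarrow> nat"
    and stack_code :: "('p \<Rightarrow> nat) \<Rightarrow> 'p stack \<Rightarrow> nat" where
  "term_code e cB = 0"
| "term_code e cC = 1"
| "term_code e cE = 2"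
| "term_code e cI = 3"
| "term_code e cK = 4"
| "term_code e cW = 5"
| "term_code e cCC = 6"
| "term_code e Quote = 7"
| "term_code e (\<xi> \<cdot> \<eta>) = 8 + 2 * prod_encode (term_code e \<xi>, term_code e \<eta>)"
| "term_code e (Cont \<pi>) = 9 + 2 * stack_code e \<pi>"
| "stack_code e (Const p) = 2 * e p"
| "stack_code e (\<xi> \<bullet> \<pi>) = 1 + 2 * prod_encode (term_code e \<xi>, stack_code e \<pi>)"

lemma code_inject:
  assumes "inj e"
  shows "term_code e \<xi> = term_code e \<xi>' \<Longrightarrow> \<xi> = \<xi>'"
    and "stack_code e \<pi> = stack_code e \<pi>' \<Longrightarrow> \<pi> = \<pi>'"
proof (induction \<xi> and \<pi> arbitrary: \<xi>' and \<pi>')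
  case (App x1 x2) then show ?case by (cases \<xi>') (auto simp: prod_encode_eq | presburger)+
next
  case (Cont x) then show ?case by (cases \<xi>') (auto | presburger)+
next
  case (Const x) then show ?case using assms by (cases \<pi>') (auto dest: injD | presburger)+
next
  case (Push x1 x2) then show ?case by (cases \<pi>') (auto simp: prod_encode_eq | presburger)+
qed (case_tac \<xi>'; simp)+

lemma code_surject:
  assumes "surj e"
  shows "(\<exists>\<xi>. term_code e \<xi> = n) \<and> (\<exists>\<pi>. stack_code e \<pi> = n)"
proof (induction n rule: less_induct)
  case (less n)
  have pair: "\<exists>a b. m = prod_encode (a, b) \<and> a \<le> m \<and> b \<le> m" for m
    by (metis le_prod_encode_1 le_prod_encode_2 prod_decode_inverse surj_pair)
  have s: "\<exists>\<pi>. stack_code e \<pi> = n"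
  proof (cases "even n")
    case True
    then obtain m where "n = 2 * m" by blast
    moreover obtain p where "e p = m" using assms by (metis surjD)
    ultimately show ?thesis by (metis stack_code.simps(1))
  next
    case False
    then obtain m where m: "n = 2 * m + 1" by (blast elim: oddE)
    obtain a b where ab: "m = prod_encode (a, b)" "a \<le> m" "b \<le> m" using pair by blast
    then have "a < n" "b < n" using m by auto
    then obtain \<xi> \<pi> where "term_code e \<xi> = a" "stack_code e \<pi> = b" using less by blast
    then have "stack_code e (\<xi> \<bullet> \<pi>) = n" using m ab by simp
    then show ?thesis by blast
  qed
  have t: "\<exists>\<xi>. term_code e \<xi> = n"
  proof (cases "n < 8")
    case True
    then have "n \<in> {0, 1, 2, 3, 4, 5, 6, 7}" by auto
    then show ?thesis
      using term_code.simps(1-8)[of e] by (metis empty_iff insert_iff)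
  next
    case False
    then obtain m where "n = 8 + m" by (metis le_add_diff_inverse not_less)
    then consider k where "n = 8 + 2 * k" | k where "n = 9 + 2 * k"
      by (cases "even m") (auto elim!: evenE oddE)
    then show ?thesis
    proof cases
      case 1
      obtain a b where ab: "k = prod_encode (a, b)" "a \<le> k" "b \<le> k" using pair by blast
      then have "a < n" "b < n" using 1 by auto
      then obtain \<xi> \<eta> where "term_code e \<xi> = a" "term_code e \<eta> = b" using less by blast
      then have "term_code e (\<xi> \<cdot> \<eta>) = n" using 1 ab by simp
      then show ?thesis by blast
    next
      case 2
      then have "k < n" by simp
      then obtain \<pi> where "stack_code e \<pi> = k" using less by blast
      then have "term_code e (Cont \<pi>) = n" using 2 by simp
      then show ?thesis by blast
    qed
  qed
  show ?case using s t by blast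
qed

lemma bij_term_code: "bij e \<Longrightarrow> bij (term_code e)"
  unfolding bij_def inj_def surj_def using code_inject(1)[unfolded inj_def] code_surject
  by (metis surj_def)

definition recursive_from_terms :: "('p \<Rightarrow> nat) \<Rightarrow> ('p trm \<Rightarrow> nat) \<Rightarrow> bool" where
  "recursive_from_terms e f \<longleftrightarrow> (\<exists>h. recursive h \<and> (\<forall>\<xi>. f \<xi> = h (term_code e \<xi>)))"

definition recursive_to_terms :: "('p \<Rightarrow> nat) \<Rightarrow> (nat \<Rightarrow> 'p trm) \<Rightarrow> bool" where
  "recursive_to_terms e \<theta> \<longleftrightarrow> recursive (\<lambda>n. term_code e (\<theta> n))"


section \<open>Execution\<close>

definition succ_trm :: "'p trm" where
  "succ_trm = (cB \<cdot> cW) \<cdot> (cB \<cdot> cB)"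

primrec numeral_trm :: "nat \<Rightarrow> 'p trm" where
  "numeral_trm 0 = cK \<cdot> cI"
| "numeral_trm (Suc n) = succ_trm \<cdot> numeral_trm n"

inductive step :: "('p trm \<Rightarrow> nat) \<Rightarrow> 'p process \<Rightarrow> 'p process \<Rightarrow> bool"
  for num :: "'p trm \<Rightarrow> nat" where
  push:  "step num (\<xi> \<cdot> \<eta>, \<pi>) (\<xi>, \<eta> \<bullet> \<pi>)"
| I:     "step num (cI, \<xi> \<bullet> \<pi>) (\<xi>, \<pi>)"
| K:     "step num (cK, \<xi> \<bullet> \<eta> \<bullet> \<pi>) (\<xi>, \<pi>)"
| E:     "step num (cE, \<xi> \<bullet> \<eta> \<bullet> \<pi>) (\<xi> \<cdot> \<eta>, \<pi>)"
| W:     "step num (cW, \<xi> \<bullet> \<eta> \<bullet> \<pi>) (\<xi>, \<eta> \<bullet> \<eta> \<bullet> \<pi>)"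
| C:     "step num (cC, \<xi> \<bullet> \<eta> \<bullet> \<zeta> \<bullet> \<pi>) (\<xi>, \<zeta> \<bullet> \<eta> \<bullet> \<pi>)"
| B:     "step num (cB, \<xi> \<bullet> \<eta> \<bullet> \<zeta> \<bullet> \<pi>) (\<xi> \<cdot> (\<eta> \<cdot> \<zeta>), \<pi>)"
| cc:    "step num (cCC, \<xi> \<bullet> \<pi>) (\<xi>, Cont \<pi> \<bullet> \<pi>)"
| cont:  "step num (Cont \<pi>, \<xi> \<bullet> \<pi>') (\<xi>, \<pi>)"
| quote: "step num (Quote, \<xi> \<bullet> \<eta> \<bullet> \<pi>) (\<xi>, numeral_trm (num \<eta>) \<bullet> \<pi>)"

abbreviation exec :: "('p trm \<Rightarrow> nat) \<Rightarrow> 'p process \<Rightarrow> 'p process \<Rightarrow> bool" where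
  "exec num \<equiv> (step num)\<^sup>*\<^sup>*"


section \<open>The model of threads\<close>

definition thread ::
  "('p trm \<Rightarrow> nat) \<Rightarrow> (nat \<Rightarrow> 'p) \<Rightarrow> (nat \<Rightarrow> 'p trm) \<Rightarrow> nat \<Rightarrow> 'p process set" where
  "thread num c \<theta> n = {(\<xi>, \<pi>). exec num (\<theta> n, Const (c n)) (\<xi>, \<pi>)}"

definition pole ::
  "('p trm \<Rightarrow> nat) \<Rightarrow> (nat \<Rightarrow> 'p) \<Rightarrow> (nat \<Rightarrow> 'p trm) \<Rightarrow> 'p process set" where
  "pole num c \<theta> = - (\<Union>n. thread num c \<theta> n)"

definition realizes_bot ::
  "('p trm \<Rightarrow> nat) \<Rightarrow> (nat \<Rightarrow> 'p) \<Rightarrow> (nat \<Rightarrow> 'p trm) \<Rightarrow> 'p trm \<Rightarrow> bool" where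
  "realizes_bot num c \<theta> \<xi> \<longleftrightarrow> (\<forall>\<pi>. (\<xi>, \<pi>) \<in> pole num c \<theta>)"

end

theory Submission imports Defs begin

text \<open>
  Execution is deterministic, so any two processes of one thread are comparable, and only the
  constant \<open>\<pi>\<^sub>n\<close> occurs in the \<open>n\<close>-th thread, so two processes that mention the same continuation
  \<open>k\<^sub>\<pi>\<close> cannot lie in different threads. For (1) and (3) take \<open>\<omega>\<close> to be a looping term: once one of
  the two processes is reached, the thread is trapped in a loop that avoids the other one. For (2)
  and (4), \<open>k\<^sub>\<pi>\<alpha>\<zeta>\<close> always leads to \<open>\<alpha> \<star> \<pi>\<close> in three steps. If three such processes occurred, the
  last two would be reached from \<open>\<alpha> \<star> \<pi>\<close>, but whichever comes first leads back to \<open>\<alpha> \<star> \<pi>\<close>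
  before the other one can occur.
\<close>

lemma step_deterministic: "step num p q \<Longrightarrow> step num p q' \<Longrightarrow> q = q'"
  by (erule step.cases; erule step.cases; simp)

text \<open>Determinism makes two runs from \<open>p\<close> share their first step unless one of
  them is empty; peeling off shared steps shows that the shorter run is a prefix of the
  longer.\<close>

lemma exec_linear:
  assumes "exec num p q" "exec num p q'"
  shows "exec num q q' \<or> exec num q' q"
  using assms
proof (induction rule: converse_rtranclp_induct)
  case base
  then show ?case by blast
next
  case (step p r)
  from \<open>exec num p q'\<close> show ?case
  proof (cases rule: converse_rtranclpE)
    case base
    then show ?thesis using step.hyps by (meson converse_rtranclp_into_rtranclp)
  next
    case (step r')
    then show ?thesis using step.IH step.hyps step_deterministic by metis
  qed
qed

lemma exec_first_step:
  assumes "exec num p q" "p \<noteq> q" "step num p r"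
  shows "exec num r q"
  using assms by (metis converse_rtranclpE step_deterministic)

text \<open>Counts the steps of \<open>exec_first_step\<close>; the count feeds the descent in
  \<open>cont_app2_relpowp_unique\<close>.\<close>

lemma relpowp_first_step:
  assumes "(step num ^^ n) p q" "p \<noteq> q" "step num p r"
  obtains m where "n = Suc m" "(step num ^^ m) r q"
proof (cases n)
  case (Suc m)
  then obtain s where "step num p s" "(step num ^^ m) s q"
    using assms(1) by (metis relpowp_Suc_D2)
  with Suc that assms(3) show ?thesis using step_deterministic by metis
qed (use assms in simp)

lemma relpowp_suffix:
  assumes "(step num ^^ i) p q" "(step num ^^ (i + j)) p r"
  shows "(step num ^^ j) q r"
  using assms
proof (induction i arbitrary: p)
  case (Suc i)
  then obtain s s' where "step num p s" "(step num ^^ i) s q"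
    "step num p s'" "(step num ^^ (i + j)) s' r"
    by (metis add_Suc relpowp_Suc_D2)
  then show ?case using Suc.IH step_deterministic by metis
qed simp

lemma set_numeral_trm: "set_trm (numeral_trm n) = {}"
  by (induction n) (auto simp: succ_trm_def)

lemma set_proof_like: "proof_like \<xi> \<Longrightarrow> set_trm \<xi> = {}"
  by (induction \<xi> rule: proof_like.induct) auto

text \<open>Every stack ends in a constant, so any term that mentions \<open>Cont \<pi>\<close>
  mentions a constant, and this constant identifies its thread. The mutual induction rule is used
  with a trivial predicate for terms.\<close>

lemma set_stack_nonempty: "set_stack \<pi> \<noteq> {}"
  by (rule stack.induct[of "\<lambda>_. True" "\<lambda>\<pi>. set_stack \<pi> \<noteq> {}"]) auto

text \<open>Rules only rearrange, copy or erase material already present, except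
  \<open>quote\<close>, whose new numeral contains no constant.\<close>

lemma step_constants:
  "step num p q \<Longrightarrow> set_trm (fst q) \<union> set_stack (snd q) \<subseteq> set_trm (fst p) \<union> set_stack (snd p)"
  by (induction rule: step.induct) (auto simp: set_numeral_trm)

lemma exec_constants:
  "exec num p q \<Longrightarrow> set_trm (fst q) \<union> set_stack (snd q) \<subseteq> set_trm (fst p) \<union> set_stack (snd p)"
  by (induction rule: rtranclp_induct) (use step_constants in blast)+

lemma thread_constants:
  assumes "proof_like (\<theta> n)" "(\<xi>, \<pi>) \<in> thread num c \<theta> n"
  shows "set_trm \<xi> \<subseteq> {c n}"
  using assms exec_constants[of num "(\<theta> n, Const (c n))" "(\<xi>, \<pi>)"]
  by (auto simp: thread_def set_proof_like)

text \<open>\<open>cW \<cdot> cI\<close> duplicates its argument and applies it to itself, so this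
  is the combinatory form of the looping lambda term (\<lambda>x. x x)(\<lambda>x. x x).\<close>

definition omega :: "'p trm" where
  "omega = (cW \<cdot> cI) \<cdot> (cW \<cdot> cI)"

lemma proof_like_omega: "proof_like omega"
  by (simp add: omega_def)

text \<open>The run is a finite cycle with \<open>\<rho>\<close> untouched at the bottom: after the
  first push, the last three of the four listed processes repeat for ever, so the list is closed
  under \<open>step\<close>.\<close>

lemma omega_loop:
  assumes "exec num (omega, \<rho>) q"
  shows "fst q \<in> {omega, cW \<cdot> cI, cW, cI}"
proof -
  let ?d = "cW \<cdot> cI :: 'a trm"
  have "q \<in> {(omega, \<rho>), (?d, ?d \<bullet> \<rho>), (cW, cI \<bullet> ?d \<bullet> \<rho>), (cI, ?d \<bullet> ?d \<bullet> \<rho>)}"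
    using assms
  proof (induction rule: rtranclp_induct)
    case (step q r)
    from step.hyps(2) step.IH show ?case
      by (cases rule: step.cases) (auto simp: omega_def)
  qed simp
  then show ?thesis by auto
qed

text \<open>One push buries \<open>\<xi>\<close> under the loop, and it never returns to head
  position.\<close>

lemma omega_app_loop:
  assumes "exec num (omega \<cdot> \<xi>, \<rho>) q" "q \<noteq> (omega \<cdot> \<xi>, \<rho>)"
  shows "fst q \<in> {omega, cW \<cdot> cI, cW, cI}"
  using omega_loop exec_first_step[OF assms(1) assms(2)[symmetric] step.push] by metis

lemma omega_app2_loop:
  assumes "exec num (omega \<cdot> \<xi> \<cdot> \<eta>, \<rho>) q" "q \<noteq> (omega \<cdot> \<xi> \<cdot> \<eta>, \<rho>)"
  shows "fst q \<in> {omega \<cdot> \<xi>, omega, cW \<cdot> cI, cW, cI}"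
proof (cases "q = (omega \<cdot> \<xi>, \<eta> \<bullet> \<rho>)")
  case False
  then show ?thesis
    using omega_app_loop[OF exec_first_step[OF assms(1) assms(2)[symmetric] step.push]] by blast
qed simp

text \<open>The three steps are two pushes and the continuation jump, which discards both
  \<open>\<zeta>\<close> and \<open>\<rho>\<close>. None of them can be the end of the run: at the
  start because \<open>\<zeta> \<noteq> \<zeta>'\<close>, afterwards because the head has a
  different shape.\<close>

lemma cont_app2_steps:
  assumes "(step num ^^ n) (Cont \<pi> \<cdot> \<alpha> \<cdot> \<zeta>, \<rho>) (Cont \<pi> \<cdot> \<alpha> \<cdot> \<zeta>', \<rho>')" "\<zeta> \<noteq> \<zeta>'"
  obtains m where "n = m + 3" "(step num ^^ m) (\<alpha>, \<pi>) (Cont \<pi> \<cdot> \<alpha> \<cdot> \<zeta>', \<rho>')"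
proof -
  obtain n1 where n1: "n = Suc n1"
    "(step num ^^ n1) (Cont \<pi> \<cdot> \<alpha>, \<zeta> \<bullet> \<rho>) (Cont \<pi> \<cdot> \<alpha> \<cdot> \<zeta>', \<rho>')"
    by (rule relpowp_first_step[OF assms(1) _ step.push]) (use assms(2) in auto)
  obtain n2 where n2: "n1 = Suc n2"
    "(step num ^^ n2) (Cont \<pi>, \<alpha> \<bullet> \<zeta> \<bullet> \<rho>) (Cont \<pi> \<cdot> \<alpha> \<cdot> \<zeta>', \<rho>')"
    by (rule relpowp_first_step[OF n1(2) _ step.push]) auto
  obtain n3 where n3: "n2 = Suc n3"
    "(step num ^^ n3) (\<alpha>, \<pi>) (Cont \<pi> \<cdot> \<alpha> \<cdot> \<zeta>', \<rho>')"
    by (rule relpowp_first_step[OF n2(2) _ step.cont]) auto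
  from that[of n3] n1 n2 n3 show ?thesis by simp
qed

lemma cont_app2_exec:
  assumes "exec num (Cont \<pi> \<cdot> \<alpha> \<cdot> \<zeta>, \<rho>) (Cont \<pi> \<cdot> \<alpha> \<cdot> \<zeta>', \<rho>')" "\<zeta> \<noteq> \<zeta>'"
  shows "exec num (\<alpha>, \<pi>) (Cont \<pi> \<cdot> \<alpha> \<cdot> \<zeta>', \<rho>')"
  using assms by (metis cont_app2_steps rtranclp_power)

text \<open>Descent on the total length: if the arguments differ, the target reached first jumps
  back to \<open>(\<alpha>, \<pi>)\<close>, whence the other target is reached by a strictly shorter
  run, contradicting the induction hypothesis.\<close>

lemma cont_app2_relpowp_unique:
  assumes "(step num ^^ i) (\<alpha>, \<pi>) (Cont \<pi> \<cdot> \<alpha> \<cdot> \<zeta>, \<rho>)"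
    and "(step num ^^ j) (\<alpha>, \<pi>) (Cont \<pi> \<cdot> \<alpha> \<cdot> \<zeta>', \<rho>')"
  shows "\<zeta> = \<zeta>'"
  using assms
proof (induction "i + j" arbitrary: i j \<zeta> \<zeta>' \<rho> \<rho>' rule: less_induct)
  case less
  \<comment> \<open>Kept general in both runs so that it serves either order of \<open>i\<close> and
    \<open>j\<close>. The gain is \<open>i + 3\<close> steps, hence strict even for
    \<open>i = 0\<close>.\<close>
  have shorter: "\<exists>m<j. (step num ^^ m) (\<alpha>, \<pi>) (Cont \<pi> \<cdot> \<alpha> \<cdot> \<zeta>', \<rho>')"
    if steps: "(step num ^^ i) (\<alpha>, \<pi>) (Cont \<pi> \<cdot> \<alpha> \<cdot> \<zeta>, \<rho>)"
      "(step num ^^ j) (\<alpha>, \<pi>) (Cont \<pi> \<cdot> \<alpha> \<cdot> \<zeta>', \<rho>')" "\<zeta> \<noteq> \<zeta>'" "i \<le> j"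
    for i j \<zeta> \<zeta>' \<rho> \<rho>'
  proof -
    obtain k where k: "j = i + k" using \<open>i \<le> j\<close> le_Suc_ex by blast
    obtain m where "k = m + 3" "(step num ^^ m) (\<alpha>, \<pi>) (Cont \<pi> \<cdot> \<alpha> \<cdot> \<zeta>', \<rho>')"
      using cont_app2_steps[OF relpowp_suffix[OF steps(1) steps(2)[unfolded k]] steps(3)] by blast
    with k show ?thesis by (intro exI[of _ m]) simp
  qed
  show ?case
  proof (rule ccontr)
    assume ne: "\<zeta> \<noteq> \<zeta>'"
    show False
    proof (cases "i \<le> j")
      case True
      then obtain m where "m < j" "(step num ^^ m) (\<alpha>, \<pi>) (Cont \<pi> \<cdot> \<alpha> \<cdot> \<zeta>', \<rho>')"
        using shorter less.prems ne by blast
      with less.hyps[of i m] less.prems(1) ne show False by auto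
    next
      case False
      then obtain m where "m < i" "(step num ^^ m) (\<alpha>, \<pi>) (Cont \<pi> \<cdot> \<alpha> \<cdot> \<zeta>, \<rho>)"
        using shorter less.prems ne by (metis nat_le_linear)
      with less.hyps[of m j] less.prems(2) ne show False by auto
    qed
  qed
qed

lemma cont_app2_unique:
  assumes "exec num (\<alpha>, \<pi>) (Cont \<pi> \<cdot> \<alpha> \<cdot> \<zeta>, \<rho>)"
    and "exec num (\<alpha>, \<pi>) (Cont \<pi> \<cdot> \<alpha> \<cdot> \<zeta>', \<rho>')"
  shows "\<zeta> = \<zeta>'"
  using assms cont_app2_relpowp_unique by (metis rtranclp_power)

lemma cont_app2_no_three:
  assumes "exec num p (Cont \<pi> \<cdot> \<alpha> \<cdot> \<zeta>0, \<rho>0)" "exec num p (Cont \<pi> \<cdot> \<alpha> \<cdot> \<zeta>1, \<rho>1)"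
    "exec num p (Cont \<pi> \<cdot> \<alpha> \<cdot> \<zeta>2, \<rho>2)"
  shows "\<zeta>0 = \<zeta>1 \<or> \<zeta>0 = \<zeta>2 \<or> \<zeta>1 = \<zeta>2"
proof (rule ccontr)
  assume ne: "\<not> ?thesis"
  \<comment> \<open>Of any two targets, the later one is reached from
    \<open>(\<alpha>, \<pi>)\<close>. Applied to all three pairs, this leaves at most one target not
    so reached, hence two that are.\<close>
  have linear: "exec num (\<alpha>, \<pi>) (Cont \<pi> \<cdot> \<alpha> \<cdot> \<zeta>, \<rho>) \<or> exec num (\<alpha>, \<pi>) (Cont \<pi> \<cdot> \<alpha> \<cdot> \<zeta>', \<rho>')"
    if "exec num p (Cont \<pi> \<cdot> \<alpha> \<cdot> \<zeta>, \<rho>)" "exec num p (Cont \<pi> \<cdot> \<alpha> \<cdot> \<zeta>', \<rho>')" "\<zeta> \<noteq> \<zeta>'"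
    for \<zeta> \<zeta>' \<rho> \<rho>'
    using exec_linear[OF that(1,2)] cont_app2_exec that(3) by metis
  show False
    using linear[OF assms(1,2)] linear[OF assms(1,3)] linear[OF assms(2,3)] cont_app2_unique ne
    by metis
qed

text \<open>The starting process depends on \<open>x\<close> alone and not on \<open>\<xi>\<close>,
  so all terms that mention \<open>x\<close> and reach head position share one run.\<close>

lemma not_realizes_bot_thread:
  assumes "\<And>n. proof_like (\<theta> n)" "inj c" "x \<in> set_trm \<xi>" "\<not> realizes_bot num c \<theta> \<xi>"
  obtains \<rho> where "exec num (\<theta> (inv c x), Const x) (\<xi>, \<rho>)"
proof -
  obtain n \<rho> where n: "(\<xi>, \<rho>) \<in> thread num c \<theta> n"
    using assms(4) by (auto simp: realizes_bot_def pole_def)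
  then have "c n = x" using thread_constants assms(1,3) by fast
  then have "inv c x = n" using assms(2) by auto
  with that n \<open>c n = x\<close> show ?thesis by (auto simp: thread_def)
qed

theorem theorem5p10:
  fixes e :: "'p \<Rightarrow> nat"
    and num :: "'p trm \<Rightarrow> nat"
    and c :: "nat \<Rightarrow> 'p"
    and \<theta> :: "nat \<Rightarrow> 'p trm"
  assumes "bij e"
    and "bij num" and "recursive_from_terms e num"
    and "bij c"
    and "range \<theta> = {\<xi>. proof_like \<xi>}" and "recursive_to_terms e \<theta>"
  shows
    "(\<exists>\<omega>0 \<omega>1. proof_like \<omega>0 \<and> proof_like \<omega>1 \<and>
        (\<forall>\<pi>. realizes_bot num c \<theta> (\<omega>0 \<cdot> Cont \<pi>) \<or> realizes_bot num c \<theta> (\<omega>1 \<cdot> Cont \<pi>)))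
   \<and> (\<exists>\<alpha>0 \<alpha>1 \<alpha>2. proof_like \<alpha>0 \<and> proof_like \<alpha>1 \<and> proof_like \<alpha>2 \<and>
        (\<forall>\<xi> \<pi>. realizes_bot num c \<theta> (Cont \<pi> \<cdot> \<xi> \<cdot> \<alpha>0) \<or> realizes_bot num c \<theta> (Cont \<pi> \<cdot> \<xi> \<cdot> \<alpha>1)
             \<or> realizes_bot num c \<theta> (Cont \<pi> \<cdot> \<xi> \<cdot> \<alpha>2)))
   \<and> (\<exists>\<omega>. proof_like \<omega> \<and>
        (\<forall>\<xi> \<xi>' \<pi>. \<xi> \<noteq> \<xi>' \<longrightarrow> realizes_bot num c \<theta> (\<omega> \<cdot> Cont \<pi> \<cdot> \<xi>) \<or> realizes_bot num c \<theta> (\<omega> \<cdot> Cont \<pi> \<cdot> \<xi>')))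
   \<and> (\<forall>\<alpha> \<pi> \<zeta>0 \<zeta>1 \<zeta>2. \<zeta>0 \<noteq> \<zeta>1 \<and> \<zeta>0 \<noteq> \<zeta>2 \<and> \<zeta>1 \<noteq> \<zeta>2 \<longrightarrow>
        realizes_bot num c \<theta> (Cont \<pi> \<cdot> \<alpha> \<cdot> \<zeta>0) \<or> realizes_bot num c \<theta> (Cont \<pi> \<cdot> \<alpha> \<cdot> \<zeta>1)
      \<or> realizes_bot num c \<theta> (Cont \<pi> \<cdot> \<alpha> \<cdot> \<zeta>2))"
proof -
  have pl: "proof_like (\<theta> n)" for n using \<open>range \<theta> = _\<close> by blast
  \<comment> \<open>The order of quantifiers matters: \<open>p\<close> is chosen from
    \<open>\<pi>\<close> before \<open>\<xi>\<close>. The inclusion holds whenever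
    \<open>\<xi>\<close> contains \<open>Cont \<pi>\<close>.\<close>
  have thread: "\<exists>p. \<forall>\<xi>. set_stack \<pi> \<subseteq> set_trm \<xi> \<longrightarrow>
      \<not> realizes_bot num c \<theta> \<xi> \<longrightarrow> (\<exists>\<rho>. exec num p (\<xi>, \<rho>))" for \<pi>
  proof -
    obtain x where "x \<in> set_stack \<pi>" using set_stack_nonempty[of \<pi>] by blast
    then have "\<exists>\<rho>. exec num (\<theta> (inv c x), Const x) (\<xi>, \<rho>)"
      if "set_stack \<pi> \<subseteq> set_trm \<xi>" "\<not> realizes_bot num c \<theta> \<xi>" for \<xi>
      using not_realizes_bot_thread[of \<theta> c x \<xi> num, OF pl bij_is_inj[OF \<open>bij c\<close>]] that
      by (metis subsetD)
    then show ?thesis by blast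
  qed
  then obtain p where p: "\<And>\<pi> \<xi>. set_stack \<pi> \<subseteq> set_trm \<xi> \<Longrightarrow> \<not> realizes_bot num c \<theta> \<xi> \<Longrightarrow>
      \<exists>\<rho>. exec num (p \<pi>) (\<xi>, \<rho>)"
    by metis
  have four: "realizes_bot num c \<theta> (Cont \<pi> \<cdot> \<alpha> \<cdot> \<zeta>0) \<or> realizes_bot num c \<theta> (Cont \<pi> \<cdot> \<alpha> \<cdot> \<zeta>1)
      \<or> realizes_bot num c \<theta> (Cont \<pi> \<cdot> \<alpha> \<cdot> \<zeta>2)"
    if "\<zeta>0 \<noteq> \<zeta>1 \<and> \<zeta>0 \<noteq> \<zeta>2 \<and> \<zeta>1 \<noteq> \<zeta>2" for \<alpha> \<pi> \<zeta>0 \<zeta>1 \<zeta>2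
  proof (rule ccontr)
    assume "\<not> ?thesis"
    then obtain \<rho>0 \<rho>1 \<rho>2 where "exec num (p \<pi>) (Cont \<pi> \<cdot> \<alpha> \<cdot> \<zeta>0, \<rho>0)"
      "exec num (p \<pi>) (Cont \<pi> \<cdot> \<alpha> \<cdot> \<zeta>1, \<rho>1)" "exec num (p \<pi>) (Cont \<pi> \<cdot> \<alpha> \<cdot> \<zeta>2, \<rho>2)"
      using p[of \<pi> "Cont \<pi> \<cdot> \<alpha> \<cdot> \<zeta>0"] p[of \<pi> "Cont \<pi> \<cdot> \<alpha> \<cdot> \<zeta>1"] p[of \<pi> "Cont \<pi> \<cdot> \<alpha> \<cdot> \<zeta>2"] by auto
    from cont_app2_no_three[OF this] that show False by blast
  qed
  \<comment> \<open>The extra argument \<open>cK\<close> only serves to make the second looping term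
    differ from the first: neither head occurs in the loop of the other.\<close>
  have one: "realizes_bot num c \<theta> (omega \<cdot> Cont \<pi>) \<or> realizes_bot num c \<theta> (omega \<cdot> cK \<cdot> Cont \<pi>)" for \<pi>
  proof (rule ccontr)
    assume "\<not> ?thesis"
    then obtain \<rho> \<rho>' where "exec num (p \<pi>) (omega \<cdot> Cont \<pi>, \<rho>)"
      "exec num (p \<pi>) (omega \<cdot> cK \<cdot> Cont \<pi>, \<rho>')"
      using p[of \<pi> "omega \<cdot> Cont \<pi>"] p[of \<pi> "omega \<cdot> cK \<cdot> Cont \<pi>"] by auto
    from exec_linear[OF this] show False
    proof
      assume "exec num (omega \<cdot> Cont \<pi>, \<rho>) (omega \<cdot> cK \<cdot> Cont \<pi>, \<rho>')"
      from omega_app_loop[OF this] show False by (simp add: omega_def)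
    next
      assume "exec num (omega \<cdot> cK \<cdot> Cont \<pi>, \<rho>') (omega \<cdot> Cont \<pi>, \<rho>)"
      from omega_app2_loop[OF this] show False by (simp add: omega_def)
    qed
  qed
  \<comment> \<open>Once left, a head \<open>omega \<cdot> Cont \<pi> \<cdot> \<xi>\<close> gives
    way to \<open>omega \<cdot> Cont \<pi>\<close> and its subterms, none of which is the other
    head.\<close>
  have three: "realizes_bot num c \<theta> (omega \<cdot> Cont \<pi> \<cdot> \<xi>) \<or> realizes_bot num c \<theta> (omega \<cdot> Cont \<pi> \<cdot> \<xi>')"
    if "\<xi> \<noteq> \<xi>'" for \<pi> \<xi> \<xi>'
  proof (rule ccontr)
    assume "\<not> ?thesis"
    then obtain \<rho> \<rho>' where "exec num (p \<pi>) (omega \<cdot> Cont \<pi> \<cdot> \<xi>, \<rho>)"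
      "exec num (p \<pi>) (omega \<cdot> Cont \<pi> \<cdot> \<xi>', \<rho>')"
      using p[of \<pi> "omega \<cdot> Cont \<pi> \<cdot> \<xi>"] p[of \<pi> "omega \<cdot> Cont \<pi> \<cdot> \<xi>'"] by auto
    from exec_linear[OF this] show False
    proof
      assume "exec num (omega \<cdot> Cont \<pi> \<cdot> \<xi>, \<rho>) (omega \<cdot> Cont \<pi> \<cdot> \<xi>', \<rho>')"
      from omega_app2_loop[OF this] that show False by (auto simp: omega_def)
    next
      assume "exec num (omega \<cdot> Cont \<pi> \<cdot> \<xi>', \<rho>') (omega \<cdot> Cont \<pi> \<cdot> \<xi>, \<rho>)"
      from omega_app2_loop[OF this] that show False by (auto simp: omega_def)
    qed
  qed
  have pK: "proof_like (omega \<cdot> cK)" using proof_like_omega by simp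
  have two: "\<exists>\<alpha>0 \<alpha>1 \<alpha>2. proof_like \<alpha>0 \<and> proof_like \<alpha>1 \<and> proof_like \<alpha>2 \<and>
      (\<forall>\<xi> \<pi>. realizes_bot num c \<theta> (Cont \<pi> \<cdot> \<xi> \<cdot> \<alpha>0) \<or> realizes_bot num c \<theta> (Cont \<pi> \<cdot> \<xi> \<cdot> \<alpha>1)
           \<or> realizes_bot num c \<theta> (Cont \<pi> \<cdot> \<xi> \<cdot> \<alpha>2))"
    \<comment> \<open>Any three distinct proof-like terms serve here, as (2) is an instance of
      (4).\<close>
    by (rule exI[of _ cI], rule exI[of _ cK], rule exI[of _ cW]) (simp add: four)
  show ?thesis
    using proof_like_omega pK one two three four by blast
qed

end
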